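(* Assume the gradients $\nabla f_1,\ldots,\nabla f_m$ are Lipschitz continuous with constants $L_1,\ldots,L_m$ (let $L_{\max}=\max_{j=1,\ldots,m}L_j$), and that there exists a nonempty subset $J\subseteq\{1,\ldots,m\}$ such that $f_j$ is bounded below for all $j\in J$. Let $\{X^k\}$ be the sequence of sets of nondominated points produced by the Front Steepest Descent algorithm (described in the context) and let $\{x_{j_k}\}$ be a refining linked sequence. Let $\bar k$ be the first iteration index such that $x_{j_k}=z_{j_{k-1}}^{k-1}$ for all $k>\bar k$. Then, for any $\epsilon>0$, after at most $k_{\max}$ iterations we get $\|v(x_{j_{k_{\max}}})\|\le\epsilon$, with $k_{\max}=\bar k+k_{\mathrm{ref}}$ and $k_{\mathrm{ref}}=\mathcal{O}\left(\frac1{\epsilon^2}\right)$.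
   Context: Setting. $F=(f_1,\ldots,f_m)^\top:\mathbb{R}^n\to\mathbb{R}^m$ is continuously differentiable. For $u,w\in\mathbb{R}^m$: $u\le w$ means $u_i\le w_i$ for all $i$; $u\lneqq w$ means $u\le w$ and $u\ne w$. A point $y$ is dominated by $x$ if $F(x)\lneqq F(y)$. A set of points is mutually nondominated if none of its points is dominated by another one. $\mathbf{1}\in\mathbb{R}^m$ is the all-ones vector. For $x,d\in\mathbb{R}^n$ let $\mathcal{D}(x,d)=\max_{j=1,\ldots,m}\nabla f_j(x)^\top d$. For nonempty $I\subseteq\{1,\ldots,m\}$ let $\theta^I(x)=\min_{d\in\mathbb{R}^n}\max_{j\in I}\nabla f_j(x)^\top d+\frac12\|d\|^2$ and let $v^I(x)$ be the unique minimizer; $\theta$ and $v$ denote $\theta^I$ and $v^I$ for $I=\{1,\ldots,m\}$. Front Steepest Descent algorithm. Input: a nonempty finite set $X^0$ of mutually nondominated points; $\alpha_0>0$, $\delta\in(0,1)$, $\gamma\in(0,1)$. The algorithm is run without stopping, producing an infinite sequence $\{X^k\}$. At iteration $k=0,1,\ldots$: set $\hat X^k=X^k$; then, sequentially for all $x_c\in X^k$, if $x_c\in\hat X^k$ at that moment, process $x_c$ as follows. (1) Refinement. If $\theta(x_c)<0$, set $\alpha_c^k=\max_{h\in\mathbb{N}}\{\alpha_0\delta^h\mid F(x_c+\alpha_0\delta^hv(x_c))\le F(x_c)+\mathbf{1}\gamma\alpha_0\delta^h\mathcal{D}(x_c,v(x_c))\}$; otherwise set $\alpha_c^k=0$. Set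 $z_c^k=x_c+\alpha_c^kv(x_c)$ and update $\hat X^k\leftarrow\hat X^k\setminus\{y\in\hat X^k\mid F(z_c^k)\lneqq F(y)\}\cup\{z_c^k\}$. (2) Exploration. For every nonempty proper subset $I\subsetneq\{1,\ldots,m\}$ with $\theta^I(z_c^k)<0$: if $z_c^k\in\hat X^k$ at that moment, set $\alpha_c^I=\max_{h\in\mathbb{N}}\{\alpha_0\delta^h\mid\forall y\in\hat X^k\ \exists j:\ f_j(z_c^k+\alpha_0\delta^hv^I(z_c^k))<f_j(y)\}$, let $w=z_c^k+\alpha_c^Iv^I(z_c^k)$ and update $\hat X^k\leftarrow\hat X^k\setminus\{y\in\hat X^k\mid F(w)\lneqq F(y)\}\cup\{w\}$. After all points have been considered, set $X^{k+1}=\hat X^k$. Linked sequence. A sequence $\{x_{j_k}\}$ such that, for every $k=1,2,\ldots$, the point $x_{j_k}\in X^k$ is generated at iteration $k-1$ of the algorithm (as the refinement point $z$ or as one of the exploration points $w$) while processing the point $x_{j_{k-1}}\in X^{k-1}$. It is a refining linked sequence if there exists $\bar k$ such that, for all $k>\bar k$, $x_{j_k}=z_{j_{k-1}}^{k-1}$, i.e. $x_{j_k}=x_{j_{k-1}}+\alpha_{j_{k-1}}^{k-1}v(x_{j_{k-1}})$, where $z_{j_{k-1}}^{k-1}$ and $\alpha_{j_{k-1}}^{k-1}$ are the refinement point and stepsize obtained at iteration $k-1$ when processing $x_{j_{k-1}}$. The $\mathcal{O}(1/\epsilon^2)$ refers to dependence on $\epsilon$: the hidden constant does not depend on $\epsilon$.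 *)

theory Defs
  imports "HOL-Analysis.Analysis" "HOL-Library.Landau_Symbols"
begin

definition gradient :: "('a::real_inner \<Rightarrow> real) \<Rightarrow> 'a \<Rightarrow> 'a" where
  "gradient f x = (THE g. GDERIV f x :> g)"

context
  fixes F :: "real^'n \<Rightarrow> real^'m"
begin

abbreviation grad_component :: "'m \<Rightarrow> real^'n \<Rightarrow> real^'n" where
  "grad_component j \<equiv> gradient (\<lambda>x. F x $ j)"

definition continuously_differentiable :: bool where
  "continuously_differentiable \<longleftrightarrow>
     (\<forall>x. F differentiable (at x)) \<and> (\<forall>j. continuous_on UNIV (grad_component j))"

text \<open>On vectors, \<open>\<le>\<close> is the componentwise order.\<close>

definition dominates :: "real^'n \<Rightarrow> real^'n \<Rightarrow> bool" where
  "dominates x y \<longleftrightarrow> F x \<le> F y \<and> F x \<noteq> F y"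

definition mutually_nondominated :: "(real^'n) set \<Rightarrow> bool" where
  "mutually_nondominated X \<longleftrightarrow> (\<forall>x\<in>X. \<forall>y\<in>X. \<not> dominates x y)"

definition max_slope :: "'m set \<Rightarrow> real^'n \<Rightarrow> real^'n \<Rightarrow> real" where
  "max_slope I x d = Max ((\<lambda>j. grad_component j x \<bullet> d) ` I)"

definition descent_model :: "'m set \<Rightarrow> real^'n \<Rightarrow> real^'n \<Rightarrow> real" where
  "descent_model I x d = max_slope I x d + (norm d)\<^sup>2 / 2"

text \<open>Minima and maxima over possibly infinite sets of reals are written with
  \<open>LEAST\<close> and \<open>GREATEST\<close>: \<open>Min\<close> and \<open>Max\<close> are only meaningful on finite sets.\<close>

definition theta :: "'m set \<Rightarrow> real^'n \<Rightarrow> real" where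
  "theta I x = (LEAST t. \<exists>d. t = descent_model I x d)"

definition descent_dir :: "'m set \<Rightarrow> real^'n \<Rightarrow> real^'n" where
  "descent_dir I x = (THE d. \<forall>d'. descent_model I x d \<le> descent_model I x d')"

context
  fixes \<alpha>0 \<delta> :: real
begin

definition refine_step :: "real \<Rightarrow> real^'n \<Rightarrow> real" where
  "refine_step \<gamma> x =
     (if theta UNIV x < 0
      then GREATEST a. a \<in> {\<alpha>0 * \<delta> ^ h | h :: nat.
             F (x + (\<alpha>0 * \<delta> ^ h) *\<^sub>R descent_dir UNIV x)
               \<le> F x + (\<gamma> * (\<alpha>0 * \<delta> ^ h) * max_slope UNIV x (descent_dir UNIV x)) *\<^sub>R 1}
      else 0)"

definition refine_point :: "real \<Rightarrow> real^'n \<Rightarrow> real^'n" where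
  "refine_point \<gamma> x = x + refine_step \<gamma> x *\<^sub>R descent_dir UNIV x"

definition explore_step :: "(real^'n) set \<Rightarrow> real^'n \<Rightarrow> 'm set \<Rightarrow> real" where
  "explore_step Y z I =
     (GREATEST a. a \<in> {\<alpha>0 * \<delta> ^ h | h :: nat.
        \<forall>y\<in>Y. \<exists>j. F (z + (\<alpha>0 * \<delta> ^ h) *\<^sub>R descent_dir I z) $ j < F y $ j})"

definition explore_point :: "(real^'n) set \<Rightarrow> real^'n \<Rightarrow> 'm set \<Rightarrow> real^'n" where
  "explore_point Y z I = z + explore_step Y z I *\<^sub>R descent_dir I z"

end

definition update_front :: "real^'n \<Rightarrow> (real^'n) set \<Rightarrow> (real^'n) set" where
  "update_front w Y = (Y - {y \<in> Y. dominates w y}) \<union> {w}"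

text \<open>The order in which the algorithm treats index sets and points is unspecified, so
  both loops are relations. \<open>exploration \<alpha>0 \<delta> z \<I> Y Y' W\<close>: exploring from \<open>z\<close> the
  index sets still pending in \<open>\<I>\<close>, in some order, turns the working set \<open>Y\<close> into \<open>Y'\<close>
  and generates the points \<open>W\<close>.\<close>

inductive exploration ::
  "real \<Rightarrow> real \<Rightarrow> real^'n \<Rightarrow> 'm set set \<Rightarrow> (real^'n) set \<Rightarrow> (real^'n) set \<Rightarrow> (real^'n) set \<Rightarrow> bool"
  for \<alpha>0 \<delta> :: real and z :: "real^'n"
where
  expl_done: "exploration \<alpha>0 \<delta> z {} Y Y {}"
| expl_point: "\<lbrakk>I \<in> \<I>; z \<in> Y; w = explore_point \<alpha>0 \<delta> Y z I;
     exploration \<alpha>0 \<delta> z (\<I> - {I}) (update_front w Y) Y' W\<rbrakk>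
   \<Longrightarrow> exploration \<alpha>0 \<delta> z \<I> Y Y' (insert w W)"
| expl_skip: "\<lbrakk>I \<in> \<I>; z \<notin> Y; exploration \<alpha>0 \<delta> z (\<I> - {I}) Y Y' W\<rbrakk>
   \<Longrightarrow> exploration \<alpha>0 \<delta> z \<I> Y Y' W"

text \<open>\<open>sweep \<alpha>0 \<delta> \<gamma> C Y Y' G\<close>: handling the points still pending in \<open>C\<close>, in some order,
  turns the working set \<open>Y\<close> into \<open>Y'\<close>; \<open>(x, p) \<in> G\<close> records that \<open>p\<close> was generated (by
  refinement or exploration) while processing \<open>x\<close>.\<close>

inductive sweep ::
  "real \<Rightarrow> real \<Rightarrow> real \<Rightarrow> (real^'n) set \<Rightarrow> (real^'n) set \<Rightarrow> (real^'n) set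
     \<Rightarrow> ((real^'n) \<times> (real^'n)) set \<Rightarrow> bool"
  for \<alpha>0 \<delta> \<gamma> :: real
where
  sweep_done: "sweep \<alpha>0 \<delta> \<gamma> {} Y Y {}"
| sweep_process: "\<lbrakk>x \<in> C; x \<in> Y; z = refine_point \<alpha>0 \<delta> \<gamma> x;
     exploration \<alpha>0 \<delta> z {I. I \<noteq> {} \<and> I \<subset> UNIV \<and> theta I z < 0} (update_front z Y) Y' W;
     sweep \<alpha>0 \<delta> \<gamma> (C - {x}) Y' Y'' G\<rbrakk>
   \<Longrightarrow> sweep \<alpha>0 \<delta> \<gamma> C Y Y'' ({x} \<times> insert z W \<union> G)"
| sweep_skip: "\<lbrakk>x \<in> C; x \<notin> Y; sweep \<alpha>0 \<delta> \<gamma> (C - {x}) Y Y' G\<rbrakk>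
   \<Longrightarrow> sweep \<alpha>0 \<delta> \<gamma> C Y Y' G"

text \<open>\<open>X k\<close> is the set of points at iteration \<open>k\<close>, \<open>G k\<close> the parent-child pairs
  generated during it.\<close>

definition front_steepest_descent ::
  "real \<Rightarrow> real \<Rightarrow> real \<Rightarrow> (nat \<Rightarrow> (real^'n) set) \<Rightarrow> (nat \<Rightarrow> ((real^'n) \<times> (real^'n)) set) \<Rightarrow> bool"
where
  "front_steepest_descent \<alpha>0 \<delta> \<gamma> X G \<longleftrightarrow>
     finite (X 0) \<and> X 0 \<noteq> {} \<and> mutually_nondominated (X 0) \<and>
     (\<forall>k. sweep \<alpha>0 \<delta> \<gamma> (X k) (X k) (X (Suc k)) (G k))"

definition refining_from :: "real \<Rightarrow> real \<Rightarrow> real \<Rightarrow> (nat \<Rightarrow> real^'n) \<Rightarrow> nat \<Rightarrow> bool" where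
  "refining_from \<alpha>0 \<delta> \<gamma> x K \<longleftrightarrow> (\<forall>k>K. x k = refine_point \<alpha>0 \<delta> \<gamma> (x (k - 1)))"

end

definition linked_sequence ::
  "(nat \<Rightarrow> 'a set) \<Rightarrow> (nat \<Rightarrow> ('a \<times> 'a) set) \<Rightarrow> (nat \<Rightarrow> 'a) \<Rightarrow> bool"
where
  "linked_sequence X G x \<longleftrightarrow>
     (\<forall>k\<ge>1. x (k - 1) \<in> X (k - 1) \<and> x k \<in> X k \<and> (x (k - 1), x k) \<in> G (k - 1))"

definition refining_linked_sequence ::
  "(real^'n \<Rightarrow> real^'m) \<Rightarrow> real \<Rightarrow> real \<Rightarrow> real \<Rightarrow> (nat \<Rightarrow> (real^'n) set)
     \<Rightarrow> (nat \<Rightarrow> ((real^'n) \<times> (real^'n)) set) \<Rightarrow> (nat \<Rightarrow> real^'n) \<Rightarrow> bool"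
where
  "refining_linked_sequence F \<alpha>0 \<delta> \<gamma> X G x \<longleftrightarrow>
     linked_sequence X G x \<and> (\<exists>K. refining_from F \<alpha>0 \<delta> \<gamma> x K)"

end

theory Submission
  imports Defs
begin

text \<open>Along the refining part of the sequence every step is an Armijo step in the steepest
  descent direction. Since \<open>v(x)\<close> minimizes \<open>\<D>(x, d) + \<parallel>d\<parallel>\<^sup>2 / 2\<close>, whose value at \<open>d = 0\<close> is \<open>0\<close>,
  we have \<open>\<D>(x, v(x)) \<le> - \<parallel>v(x)\<parallel>\<^sup>2 / 2\<close>. With Lipschitz gradients the Armijo condition holds for
  all steps below a fixed threshold, so backtracking returns steps bounded away from \<open>0\<close>. Hence
  every objective decreases by at least \<open>\<beta> \<parallel>v(x)\<parallel>\<^sup>2\<close> per iteration, for a fixed \<open>\<beta> > 0\<close>; an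
  objective that is bounded below allows only \<open>O(1/\<epsilon>\<^sup>2)\<close> iterations with \<open>\<parallel>v(x)\<parallel> > \<epsilon>\<close>.\<close>

section \<open>Gradients and the quadratic upper bound\<close>

text \<open>\<open>gradient\<close> is a definite description, so existence and uniqueness are both
  due. A linear functional on a Euclidean space is the inner product with the vector whose
  coordinates are its values on \<open>Basis\<close>.\<close>

lemma gderiv_gradient:
  fixes f :: "'a::euclidean_space \<Rightarrow> real"
  assumes "f differentiable (at x)"
  shows "GDERIV f x :> gradient f x"
proof -
  from assms obtain f' where f': "(f has_derivative f') (at x)"
    unfolding differentiable_def by blast
  let ?g = "\<Sum>b\<in>Basis. f' b *\<^sub>R b"
  have lin: "linear f'"
    using f' has_derivative_linear by blast
  have "f' = (\<lambda>h. h \<bullet> ?g)"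
  proof
    fix h
    have "f' h = f' (\<Sum>b\<in>Basis. (h \<bullet> b) *\<^sub>R b)"
      by (simp add: euclidean_representation)
    also have "\<dots> = (\<Sum>b\<in>Basis. (h \<bullet> b) * f' b)"
      using lin by (simp add: linear_sum linear_scale)
    also have "\<dots> = h \<bullet> ?g"
      by (simp add: inner_sum_right mult.commute)
    finally show "f' h = h \<bullet> ?g" .
  qed
  with f' have "GDERIV f x :> ?g"
    unfolding gderiv_def by metis
  moreover have "g = g'" if "GDERIV f x :> g" "GDERIV f x :> g'" for g g'
  proof -
    have "(\<lambda>h. h \<bullet> g) = (\<lambda>h. h \<bullet> g')"
      using that has_derivative_unique unfolding gderiv_def by blast
    then have "(g - g') \<bullet> (g - g') = 0"
      by (metis inner_diff_right right_minus_eq)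
    then show ?thesis
      by simp
  qed
  ultimately have "\<exists>!g. GDERIV f x :> g"
    by blast
  then show ?thesis
    unfolding gradient_def by (rule theI')
qed

text \<open>By the mean value theorem the increment is governed by the gradient at an intermediate
  point, which differs from \<open>gradient f x\<close> by at most \<open>L * t * norm v\<close>.
  This yields the factor \<open>L\<close> instead of the sharper \<open>L / 2\<close>, which affects
  only constants.\<close>

lemma gradient_lipschitz_upper_bound:
  fixes f :: "'a::euclidean_space \<Rightarrow> real"
  assumes diff: "\<And>x. f differentiable (at x)"
    and lip: "L-lipschitz_on UNIV (gradient f)" and "0 \<le> t"
  shows "f (x + t *\<^sub>R v) \<le> f x + t * (gradient f x \<bullet> v) + L * t\<^sup>2 * (norm v)\<^sup>2"
proof (cases "t = 0")
  case False
  with \<open>0 \<le> t\<close> have "0 < t" by simp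
  have "((\<lambda>s. f (x + s *\<^sub>R v)) has_real_derivative v \<bullet> gradient f (x + s *\<^sub>R v)) (at s)" for s
  proof -
    have "((\<lambda>s. x + s *\<^sub>R v) has_derivative (\<lambda>s. s *\<^sub>R v)) (at s)"
      by (auto intro!: derivative_eq_intros)
    moreover have "(f has_derivative (\<lambda>h. h \<bullet> gradient f (x + s *\<^sub>R v))) (at (x + s *\<^sub>R v))"
      using gderiv_gradient[OF diff] unfolding gderiv_def .
    ultimately have "((\<lambda>s. f (x + s *\<^sub>R v)) has_derivative
        (\<lambda>h. (h *\<^sub>R v) \<bullet> gradient f (x + s *\<^sub>R v))) (at s)"
      by (rule has_derivative_compose)
    then show ?thesis
      by (simp add: has_field_derivative_def mult_commute_abs)
  qed
  with MVT2[OF \<open>0 < t\<close>, of "\<lambda>s. f (x + s *\<^sub>R v)" "\<lambda>s. v \<bullet> gradient f (x + s *\<^sub>R v)"]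
  obtain s where s: "0 < s" "s < t"
    and eq: "f (x + t *\<^sub>R v) - f x = t * (v \<bullet> gradient f (x + s *\<^sub>R v))"
    by auto
  have L: "0 \<le> L"
    using lip by (rule lipschitz_on_nonneg)
  have "v \<bullet> (gradient f (x + s *\<^sub>R v) - gradient f x)
      \<le> norm v * norm (gradient f (x + s *\<^sub>R v) - gradient f x)"
    by (rule norm_cauchy_schwarz)
  also have "\<dots> \<le> norm v * (L * (s * norm v))"
    using lipschitz_onD[OF lip, of "x + s *\<^sub>R v" x] s
    by (intro mult_left_mono) (auto simp: dist_norm)
  also have "\<dots> \<le> norm v * (L * (t * norm v))"
    using s L by (intro mult_left_mono mult_right_mono) auto
  finally have "t * (v \<bullet> (gradient f (x + s *\<^sub>R v) - gradient f x))
      \<le> t * (norm v * (L * (t * norm v)))"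
    using \<open>0 < t\<close> by (intro mult_left_mono) auto
  then show ?thesis
    using eq by (simp add: inner_diff_right algebra_simps power2_eq_square inner_commute)
qed simp

section \<open>The steepest descent subproblem\<close>

lemma slope_le_max_slope:
  fixes F :: "real^'n \<Rightarrow> real^'m"
  shows "j \<in> I \<Longrightarrow> gradient (\<lambda>x. F x $ j) x \<bullet> d \<le> max_slope F I x d"
  unfolding max_slope_def by (rule Max_ge) auto

lemma max_slope_attained:
  fixes F :: "real^'n \<Rightarrow> real^'m"
  assumes "I \<noteq> {}"
  obtains j where "j \<in> I" "max_slope F I x d = gradient (\<lambda>x. F x $ j) x \<bullet> d"
proof -
  have "max_slope F I x d \<in> (\<lambda>j. gradient (\<lambda>x. F x $ j) x \<bullet> d) ` I"
    unfolding max_slope_def using assms by (intro Max_in) auto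
  then show thesis
    using that by blast
qed

lemma descent_model_zero:
  fixes F :: "real^'n \<Rightarrow> real^'m"
  assumes "I \<noteq> {}"
  shows "descent_model F I x 0 = 0"
  using assms by (simp add: descent_model_def max_slope_def image_constant_conv)

lemma continuous_on_descent_model:
  fixes F :: "real^'n \<Rightarrow> real^'m"
  assumes "I \<noteq> {}"
  shows "continuous_on S (descent_model F I x)"
proof -
  have "continuous_on S (\<lambda>d. Max ((\<lambda>j. gradient (\<lambda>x. F x $ j) x \<bullet> d) ` K))"
    if "finite K" "K \<noteq> {}" for K
    using that
  proof (induction K rule: finite_ne_induct)
    case (insert j K)
    then show ?case
      by (simp add: continuous_on_max continuous_on_inner)
  qed (simp add: continuous_on_inner)
  from this[OF finite assms] show ?thesis
    unfolding descent_model_def[abs_def] max_slope_def by (intro continuous_intros) auto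
qed

text \<open>Strong convexity at midpoints: a maximum of linear functions is convex, and the
  parallelogram law supplies the gap. The gap forces minimizers to be unique.\<close>

lemma descent_model_midpoint:
  fixes F :: "real^'n \<Rightarrow> real^'m"
  assumes "I \<noteq> {}"
  shows "descent_model F I x ((1/2) *\<^sub>R (d + e))
    \<le> (descent_model F I x d + descent_model F I x e) / 2 - (norm (d - e))\<^sup>2 / 8"
proof -
  obtain j where j: "j \<in> I"
    "max_slope F I x ((1/2) *\<^sub>R (d + e)) = gradient (\<lambda>x. F x $ j) x \<bullet> ((1/2) *\<^sub>R (d + e))"
    using max_slope_attained[OF assms] .
  have "max_slope F I x ((1/2) *\<^sub>R (d + e)) \<le> (max_slope F I x d + max_slope F I x e) / 2"
    using slope_le_max_slope[OF j(1), of F x d] slope_le_max_slope[OF j(1), of F x e]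
    unfolding j(2) by (simp add: inner_add_right)
  moreover have "(norm ((1/2) *\<^sub>R (d + e)))\<^sup>2
      = ((norm d)\<^sup>2 + (norm e)\<^sup>2) / 2 - (norm (d - e))\<^sup>2 / 4"
    by (simp add: power2_norm_eq_inner inner_simps inner_commute field_simps)
  ultimately show ?thesis
    unfolding descent_model_def by argo
qed

text \<open>Coercivity reduces the problem to a compact ball: a single gradient \<open>g\<close>
  with index in \<open>I\<close> already makes the model nonnegative, hence no better than at
  \<open>0\<close>, outside radius \<open>2 * norm g\<close>.\<close>

lemma descent_model_minimizer_exists:
  fixes F :: "real^'n \<Rightarrow> real^'m"
  assumes "I \<noteq> {}"
  shows "\<exists>d. \<forall>d'. descent_model F I x d \<le> descent_model F I x d'"
proof -
  obtain j where j: "j \<in> I"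
    using assms by blast
  define g where "g = gradient (\<lambda>x. F x $ j) x"
  have "\<exists>d\<in>cball 0 (2 * norm g). \<forall>e\<in>cball 0 (2 * norm g).
      descent_model F I x d \<le> descent_model F I x e"
    by (rule continuous_attains_inf[OF compact_cball _ continuous_on_descent_model[OF assms]]) simp
  then obtain d where "d \<in> cball 0 (2 * norm g)"
    and d: "\<And>e. e \<in> cball 0 (2 * norm g) \<Longrightarrow> descent_model F I x d \<le> descent_model F I x e"
    by blast
  have "descent_model F I x d \<le> descent_model F I x e" if "e \<notin> cball 0 (2 * norm g)" for e
  proof -
    have "descent_model F I x d \<le> 0"
      using d[of 0] descent_model_zero[OF assms, of F x] by simp
    also have "0 \<le> norm e * (norm e / 2 - norm g)"
      using that by simp
    also have "\<dots> \<le> g \<bullet> e + (norm e)\<^sup>2 / 2"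
      using Cauchy_Schwarz_ineq2[of g e] by (simp add: algebra_simps power2_eq_square)
    also have "\<dots> \<le> descent_model F I x e"
      using slope_le_max_slope[OF j, of F x e] unfolding descent_model_def g_def by simp
    finally show ?thesis .
  qed
  with d show ?thesis
    by blast
qed

lemma descent_model_minimizer_unique:
  fixes F :: "real^'n \<Rightarrow> real^'m"
  assumes "I \<noteq> {}"
    and "\<And>d'. descent_model F I x d \<le> descent_model F I x d'"
    and "\<And>d'. descent_model F I x e \<le> descent_model F I x d'"
  shows "d = e"
proof -
  have "(norm (d - e))\<^sup>2 \<le> 0"
    using descent_model_midpoint[OF assms(1), of F x d e]
      assms(2)[of "(1/2) *\<^sub>R (d + e)"] assms(3)[of "(1/2) *\<^sub>R (d + e)"] by argo
  then show ?thesis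
    by simp
qed

lemma descent_dir_minimizes:
  fixes F :: "real^'n \<Rightarrow> real^'m"
  assumes "I \<noteq> {}"
  shows "descent_model F I x (descent_dir F I x) \<le> descent_model F I x d"
proof -
  have "\<exists>!d. \<forall>d'. descent_model F I x d \<le> descent_model F I x d'"
    using descent_model_minimizer_exists[OF assms] descent_model_minimizer_unique[OF assms]
    by metis
  from theI'[OF this] show ?thesis
    unfolding descent_dir_def by blast
qed

lemma theta_eq_descent_model:
  fixes F :: "real^'n \<Rightarrow> real^'m"
  assumes "I \<noteq> {}"
  shows "theta F I x = descent_model F I x (descent_dir F I x)"
  unfolding theta_def by (rule Least_equality) (auto simp: descent_dir_minimizes[OF assms])

lemma max_slope_descent_dir_le:
  fixes F :: "real^'n \<Rightarrow> real^'m"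
  assumes "I \<noteq> {}"
  shows "max_slope F I x (descent_dir F I x) \<le> - (norm (descent_dir F I x))\<^sup>2 / 2"
  using descent_dir_minimizes[OF assms, of F x 0] descent_model_zero[OF assms, of F x]
  unfolding descent_model_def by simp

text \<open>If the optimal value is not negative, \<open>0\<close> is a minimizer too, and
  uniqueness applies. This covers the case in which \<open>refine_step\<close> is
  \<open>0\<close>.\<close>

lemma descent_dir_eq_zero:
  fixes F :: "real^'n \<Rightarrow> real^'m"
  assumes "I \<noteq> {}" and "\<not> theta F I x < 0"
  shows "descent_dir F I x = 0"
proof (rule descent_model_minimizer_unique[OF assms(1)])
  fix d
  show "descent_model F I x (descent_dir F I x) \<le> descent_model F I x d"
    by (rule descent_dir_minimizes[OF assms(1)])
  then show "descent_model F I x 0 \<le> descent_model F I x d"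
    using assms(2) by (simp add: theta_eq_descent_model[OF assms(1)] descent_model_zero[OF assms(1)])
qed

section \<open>Backtracking and sufficient decrease\<close>

text \<open>Powers of \<open>\<delta>\<close> decrease, so the greatest accepted step belongs to the
  least accepted exponent. If that is \<open>0\<close>, the step is \<open>\<alpha>0\<close>;
  otherwise the preceding trial was rejected, hence at least \<open>c\<close>, and one contraction
  leaves at least \<open>\<delta> * c\<close>.\<close>

lemma Greatest_backtracking:
  fixes \<alpha>0 \<delta> c :: real
  assumes "0 < \<alpha>0" "0 < \<delta>" "\<delta> < 1" "0 < c"
    and accept: "\<And>t. 0 < t \<Longrightarrow> t \<le> c \<Longrightarrow> P t"
  defines "a \<equiv> GREATEST a. a \<in> {\<alpha>0 * \<delta> ^ h | h. P (\<alpha>0 * \<delta> ^ h)}"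
  shows "P a" and "min \<alpha>0 (\<delta> * c) \<le> a"
proof -
  obtain n where "\<delta> ^ n < c / \<alpha>0"
    using real_arch_pow_inv[of "c / \<alpha>0" \<delta>] assms(1-4) by auto
  then have "P (\<alpha>0 * \<delta> ^ n)"
    using assms(1-4) by (intro accept) (auto simp: field_simps)
  then obtain h where h: "P (\<alpha>0 * \<delta> ^ h)" and least: "\<And>k. P (\<alpha>0 * \<delta> ^ k) \<Longrightarrow> h \<le> k"
    using exists_least_iff[of "\<lambda>h. P (\<alpha>0 * \<delta> ^ h)"] by (meson not_le)
  have a: "a = \<alpha>0 * \<delta> ^ h"
    unfolding a_def
  proof (rule Greatest_equality)
    show "\<alpha>0 * \<delta> ^ h \<in> {\<alpha>0 * \<delta> ^ h | h. P (\<alpha>0 * \<delta> ^ h)}"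
      using h by blast
    show "b \<le> \<alpha>0 * \<delta> ^ h" if "b \<in> {\<alpha>0 * \<delta> ^ h | h. P (\<alpha>0 * \<delta> ^ h)}" for b
      using that least assms(1-3) by (auto intro!: mult_left_mono power_decreasing)
  qed
  show "P a"
    using h a by simp
  show "min \<alpha>0 (\<delta> * c) \<le> a"
  proof (cases h)
    case (Suc k)
    then have "\<not> P (\<alpha>0 * \<delta> ^ k)"
      using least[of k] by auto
    then have "c \<le> \<alpha>0 * \<delta> ^ k"
      using accept[of "\<alpha>0 * \<delta> ^ k"] assms(1,2) by (cases "c \<le> \<alpha>0 * \<delta> ^ k") auto
    then have "\<delta> * c \<le> \<delta> * (\<alpha>0 * \<delta> ^ k)"
      using assms(2) by simp
    then show ?thesis
      using a Suc by (simp add: mult.left_commute)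
  qed (use a in simp)
qed

text \<open>Since \<open>norm v\<close> squared is at most \<open>- 2 * ?D\<close>, the quadratic
  error is at most \<open>2 * M * t * t * (- ?D)\<close>. The threshold on \<open>t\<close> is what
  lets the slack \<open>(1 - \<gamma>) * t * (- ?D)\<close> absorb it.\<close>

lemma armijo_condition:
  fixes F :: "real^'n \<Rightarrow> real^'m" and x :: "real^'n"
  assumes diff: "\<And>x. F differentiable (at x)"
    and lip: "\<And>j. (L j)-lipschitz_on UNIV (gradient (\<lambda>x. F x $ j))"
    and M: "\<And>j. L j \<le> M" "0 < M" and "0 < t" "t \<le> (1 - \<gamma>) / (2 * M)" "\<gamma> < 1"
  defines "v \<equiv> descent_dir F UNIV x"
  shows "F (x + t *\<^sub>R v) \<le> F x + (\<gamma> * t * max_slope F UNIV x v) *\<^sub>R 1"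
  unfolding less_eq_vec_def
proof
  fix j
  let ?D = "max_slope F UNIV x v"
  have D: "(norm v)\<^sup>2 \<le> - 2 * ?D"
    using max_slope_descent_dir_le[of UNIV F x] unfolding v_def by simp
  have Mt: "2 * (M * t) \<le> 1 - \<gamma>"
    using \<open>t \<le> _\<close> \<open>0 < M\<close> by (simp add: field_simps)
  have "F (x + t *\<^sub>R v) $ j
      \<le> F x $ j + t * (gradient (\<lambda>x. F x $ j) x \<bullet> v) + L j * t\<^sup>2 * (norm v)\<^sup>2"
  proof (rule gradient_lipschitz_upper_bound)
    show "(\<lambda>x. F x $ j) differentiable (at y)" for y
      using diff[of y] bounded_linear.has_derivative[OF bounded_linear_vec_nth]
      unfolding differentiable_def by blast
  qed (use lip \<open>0 < t\<close> in auto)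
  also have "\<dots> \<le> F x $ j + t * ?D + M * t\<^sup>2 * (- 2 * ?D)"
    using M D \<open>0 < t\<close> slope_le_max_slope[of j UNIV F x v]
    by (intro add_mono mult_mono mult_left_mono) auto
  also have "\<dots> = F x $ j + t * ?D + t * (2 * (M * t)) * (- ?D)"
    by (simp add: power2_eq_square)
  \<comment> \<open>Monotonicity needs \<open>- ?D\<close> to be nonnegative, which follows from
    \<open>D\<close>.\<close>
  also have "\<dots> \<le> F x $ j + t * ?D + t * (1 - \<gamma>) * (- ?D)"
    using Mt \<open>0 < t\<close> D zero_le_power2[of "norm v"]
    by (intro add_mono mult_right_mono mult_left_mono) linarith+
  also have "\<dots> = (F x + (\<gamma> * t * ?D) *\<^sub>R 1) $ j"
    by (simp add: algebra_simps)
  finally show "F (x + t *\<^sub>R v) $ j \<le> (F x + (\<gamma> * t * ?D) *\<^sub>R 1) $ j" .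
qed

lemma refine_point_sufficient_decrease:
  fixes F :: "real^'n \<Rightarrow> real^'m"
  assumes diff: "\<And>x. F differentiable (at x)"
    and lip: "\<And>j. (L j)-lipschitz_on UNIV (gradient (\<lambda>x. F x $ j))"
    and "0 < \<alpha>0" "0 < \<delta>" "\<delta> < 1" "0 < \<gamma>" "\<gamma> < 1"
  obtains \<beta> where "0 < \<beta>"
    and "\<And>x j. F (refine_point F \<alpha>0 \<delta> \<gamma> x) $ j
           \<le> F x $ j - \<beta> * (norm (descent_dir F UNIV x))\<^sup>2"
proof
  have L: "0 \<le> L j" for j
    using lip by (rule lipschitz_on_nonneg)
  \<comment> \<open>The summand \<open>1\<close> keeps \<open>M\<close> positive even if all
    Lipschitz constants vanish.\<close>
  define M where "M = 1 + sum L UNIV"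
  have M: "L j \<le> M" "0 < M" for j
    using member_le_sum[of j UNIV L] sum_nonneg[of UNIV L] L unfolding M_def
    by (auto intro: add_pos_nonneg add_increasing)
  define c where "c = (1 - \<gamma>) / (2 * M)"
  have "0 < c"
    using M \<open>\<gamma> < 1\<close> by (simp add: c_def)
  define \<alpha> where "\<alpha> = min \<alpha>0 (\<delta> * c)"
  have "0 < \<alpha>"
    using \<open>0 < c\<close> assms by (simp add: \<alpha>_def)
  then show "0 < \<gamma> * \<alpha> / 2"
    using assms by simp
  fix x :: "real^'n" and j :: 'm
  define v where "v = descent_dir F UNIV x"
  show "F (refine_point F \<alpha>0 \<delta> \<gamma> x) $ j
      \<le> F x $ j - \<gamma> * \<alpha> / 2 * (norm (descent_dir F UNIV x))\<^sup>2"
  proof (cases "theta F UNIV x < 0")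
    case True
    let ?P = "\<lambda>t. F (x + t *\<^sub>R v) \<le> F x + (\<gamma> * t * max_slope F UNIV x v) *\<^sub>R 1"
    define a where "a = refine_step F \<alpha>0 \<delta> \<gamma> x"
    have a: "a = (GREATEST a. a \<in> {\<alpha>0 * \<delta> ^ h | h. ?P (\<alpha>0 * \<delta> ^ h)})"
      using True by (simp add: a_def refine_step_def v_def)
    have accept: "?P t" if "0 < t" "t \<le> c" for t
      using armijo_condition[OF diff lip M] that \<open>\<gamma> < 1\<close> unfolding v_def c_def by blast
    note bt = Greatest_backtracking[of \<alpha>0 \<delta> c ?P,
        OF \<open>0 < \<alpha>0\<close> \<open>0 < \<delta>\<close> \<open>\<delta> < 1\<close> \<open>0 < c\<close> accept, folded a]
    have "F (refine_point F \<alpha>0 \<delta> \<gamma> x) $ j \<le> F x $ j + \<gamma> * a * max_slope F UNIV x v"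
      using bt(1) by (simp add: refine_point_def a_def v_def less_eq_vec_def)
    also have "\<dots> \<le> F x $ j + \<gamma> * a * (- (norm v)\<^sup>2 / 2)"
      using max_slope_descent_dir_le[of UNIV F x] bt(2) \<open>0 < \<alpha>\<close> \<open>0 < \<gamma>\<close>
      unfolding v_def \<alpha>_def by (intro add_left_mono mult_left_mono) auto
    \<comment> \<open>The step \<open>a\<close> depends on \<open>x\<close>; its lower bound
      \<open>\<alpha>\<close> does not, so the decrease constant is uniform.\<close>
    also have "\<dots> \<le> F x $ j - \<gamma> * \<alpha> / 2 * (norm v)\<^sup>2"
      using bt(2) \<open>0 < \<gamma>\<close> unfolding \<alpha>_def by (simp add: mult_left_mono mult_right_mono)
    finally show ?thesis
      unfolding v_def .
  next
    case False
    then show ?thesis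
      using descent_dir_eq_zero[of UNIV F x] by (simp add: refine_point_def)
  qed
qed

section \<open>Counting iterations\<close>

text \<open>The filter \<open>principal {0<..}\<close> makes the bound hold for every \<open>\<epsilon> > 0\<close>, not only
  asymptotically.\<close>

lemma first_small_index_bigo:
  fixes \<phi> r :: "nat \<Rightarrow> real"
  assumes "0 < \<beta>" and r: "\<And>i. 0 \<le> r i" and bdd: "\<And>i. b \<le> \<phi> i"
    and dec: "\<And>i. \<phi> (Suc i) \<le> \<phi> i - \<beta> * (r i)\<^sup>2"
  obtains K :: "real \<Rightarrow> nat" where "(\<lambda>\<epsilon>. real (K \<epsilon>)) \<in> O[principal {0<..}](\<lambda>\<epsilon>. 1 / \<epsilon>\<^sup>2)"
    and "\<And>\<epsilon>. 0 < \<epsilon> \<Longrightarrow> r (K \<epsilon>) \<le> \<epsilon>"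
proof
  \<comment> \<open>The total decrease available, in units of \<open>\<beta>\<close>: each index
    with \<open>r i\<close> above \<open>\<epsilon>\<close> uses up more than the square of
    \<open>\<epsilon>\<close>.\<close>
  define C where "C = (\<phi> 0 - b) / \<beta>"
  have bound: "real n \<le> C / \<epsilon>\<^sup>2" if "0 < \<epsilon>" and large: "\<And>i. i < n \<Longrightarrow> \<epsilon> < r i" for n \<epsilon>
  proof -
    have "m \<le> n \<Longrightarrow> \<phi> m \<le> \<phi> 0 - real m * (\<beta> * \<epsilon>\<^sup>2)" for m
    proof (induction m)
      case (Suc m)
      have "\<beta> * \<epsilon>\<^sup>2 \<le> \<beta> * (r m)\<^sup>2"
        using large[of m] Suc.prems \<open>0 < \<epsilon>\<close> \<open>0 < \<beta>\<close> by (intro mult_left_mono power_mono) auto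
      with Suc dec[of m] show ?case
        by (simp add: algebra_simps)
    qed simp
    from this[of n] bdd[of n] have "real n * (\<beta> * \<epsilon>\<^sup>2) \<le> \<phi> 0 - b"
      by simp
    then show ?thesis
      using \<open>0 < \<beta>\<close> \<open>0 < \<epsilon>\<close> by (simp add: C_def field_simps)
  qed
  \<comment> \<open>All indices before the first small one are large, so \<open>bound\<close>
    applies with \<open>n = K \<epsilon>\<close>.\<close>
  define K where "K = (\<lambda>\<epsilon>. LEAST n. r n \<le> \<epsilon>)"
  have ex: "\<exists>n. r n \<le> \<epsilon>" if "0 < \<epsilon>" for \<epsilon>
  proof (rule ccontr)
    assume "\<nexists>n. r n \<le> \<epsilon>"
    then have "real n \<le> C / \<epsilon>\<^sup>2" for n
      using bound[OF that] by (meson not_le)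
    then show False
      using reals_Archimedean2 not_le by blast
  qed
  show "r (K \<epsilon>) \<le> \<epsilon>" if "0 < \<epsilon>" for \<epsilon>
    using ex[OF that] unfolding K_def by (rule LeastI_ex)
  have "real (K \<epsilon>) \<le> C / \<epsilon>\<^sup>2" if "0 < \<epsilon>" for \<epsilon>
    using bound[OF that] not_less_Least unfolding K_def by (metis not_le)
  then show "(\<lambda>\<epsilon>. real (K \<epsilon>)) \<in> O[principal {0<..}](\<lambda>\<epsilon>. 1 / \<epsilon>\<^sup>2)"
    by (intro bigoI[of _ C]) (auto simp: eventually_principal)
qed

theorem proposition3p2:
  fixes F :: "real^'n \<Rightarrow> real^'m"
    and \<alpha>0 \<delta> \<gamma> :: real
    and L :: "'m \<Rightarrow> real"
    and J :: "'m set"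
    and X :: "nat \<Rightarrow> (real^'n) set"
    and G :: "nat \<Rightarrow> ((real^'n) \<times> (real^'n)) set"
    and x :: "nat \<Rightarrow> real^'n"
    and kbar :: nat
  assumes "continuously_differentiable F"
    and "0 < \<alpha>0" and "0 < \<delta>" "\<delta> < 1" and "0 < \<gamma>" "\<gamma> < 1"
    and "\<And>j. (L j)-lipschitz_on UNIV (gradient (\<lambda>x. F x $ j))"
    and "J \<noteq> {}" and "\<And>j. j \<in> J \<Longrightarrow> bdd_below (range (\<lambda>x. F x $ j))"
    and "front_steepest_descent F \<alpha>0 \<delta> \<gamma> X G"
    and "refining_linked_sequence F \<alpha>0 \<delta> \<gamma> X G x"
    and "kbar = (LEAST K. refining_from F \<alpha>0 \<delta> \<gamma> x K)"
  shows "\<exists>kref :: real \<Rightarrow> nat.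
           (\<lambda>\<epsilon>. real (kref \<epsilon>)) \<in> O[principal {0<..}](\<lambda>\<epsilon>. 1 / \<epsilon>\<^sup>2) \<and>
           (\<forall>\<epsilon>>0. norm (descent_dir F UNIV (x (kbar + kref \<epsilon>))) \<le> \<epsilon>)"
proof -
  have diff: "F differentiable (at y)" for y
    using assms(1) unfolding continuously_differentiable_def by blast
  obtain \<beta> where \<beta>: "0 < \<beta>" "\<And>y j. F (refine_point F \<alpha>0 \<delta> \<gamma> y) $ j
      \<le> F y $ j - \<beta> * (norm (descent_dir F UNIV y))\<^sup>2"
    using refine_point_sufficient_decrease[OF diff assms(7,2-6)] by blast
  have "refining_from F \<alpha>0 \<delta> \<gamma> x kbar"
    using assms(11) unfolding refining_linked_sequence_def assms(12) by (blast intro: LeastI)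
  \<comment> \<open>Refinement produces the iterates strictly after \<open>kbar\<close>, so the
    decrease is available from \<open>x kbar\<close> itself onwards.\<close>
  then have step: "x (kbar + Suc i) = refine_point F \<alpha>0 \<delta> \<gamma> (x (kbar + i))" for i
    unfolding refining_from_def by (metis add_Suc_right diff_Suc_1 le_add1 less_Suc_eq_le)
  obtain j b where "\<And>y. b \<le> F y $ j"
    using assms(8,9) unfolding bdd_below_def by fast
  moreover have "F (x (kbar + Suc i)) $ j
      \<le> F (x (kbar + i)) $ j - \<beta> * (norm (descent_dir F UNIV (x (kbar + i))))\<^sup>2" for i
    unfolding step by (rule \<beta>(2))
  \<comment> \<open>The hidden constant is the gap between objective \<open>j\<close> at
    \<open>x kbar\<close> and its lower bound \<open>b\<close>, divided by \<open>\<beta>\<close>;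
    it is free of \<open>\<epsilon>\<close>.\<close>
  ultimately obtain K :: "real \<Rightarrow> nat"
    where "(\<lambda>\<epsilon>. real (K \<epsilon>)) \<in> O[principal {0<..}](\<lambda>\<epsilon>. 1 / \<epsilon>\<^sup>2)"
      and "\<And>\<epsilon>. 0 < \<epsilon> \<Longrightarrow> norm (descent_dir F UNIV (x (kbar + K \<epsilon>))) \<le> \<epsilon>"
    using first_small_index_bigo[OF \<beta>(1), of "\<lambda>i. norm (descent_dir F UNIV (x (kbar + i)))" b
        "\<lambda>i. F (x (kbar + i)) $ j"] norm_ge_zero by blast
  then show ?thesis
    by blast
qed

end
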